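(* Let $c\in\mathbb{C}$ and $P(z)=z^2+c$. If $c=\frac14$, then $P$ has a single fixed point in $\mathbb{C}$ and its multiplier is $1$. If $c\neq\frac14$, then $P$ has two simple fixed points in $\mathbb{C}$; further, in this case the multipliers of both fixed points have real part equal to $1$ if and only if $c$ is real and $c>\frac14$. In other words, the multiplier of each fixed point of $P$ in $\mathbb{C}$ has real part equal to $1$ if and only if $c$ is real and $c\geq\frac14$.
   Context: A fixed point of a polynomial $P$ means a finite fixed point, i.e. $z_0\in\mathbb{C}$ with $P(z_0)=z_0$; its multiplier is $P'(z_0)$. A fixed point is simple if it is a simple root of $P(z)-z$. *)

theory Defs
  imports Complex_Main "HOL-Computational_Algebra.Polynomial"
begin

definition quad_poly :: "complex \<Rightarrow> complex poly" where
  "quad_poly c = monom 1 2 + [:c:]"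

definition fixed_points :: "complex poly \<Rightarrow> complex set" where
  "fixed_points p = {z. poly p z = z}"

definition multiplier :: "complex poly \<Rightarrow> complex \<Rightarrow> complex" where
  "multiplier p z = poly (pderiv p) z"

(* [:0, 1:] is the polynomial z. It is excluded because the order of a root
   of the zero polynomial is an unspecified number. *)
definition simple_fixed_point :: "complex poly \<Rightarrow> complex \<Rightarrow> bool" where
  "simple_fixed_point p z \<longleftrightarrow> p \<noteq> [:0, 1:] \<and> order z (p - [:0, 1:]) = 1"

end

theory Submission
  imports Defs
begin

text \<open>
  Let \<open>s\<close> be a square root of the discriminant \<open>1 - 4 c\<close> of \<open>P z - z\<close>. The fixed points are
  \<open>(1 \<plusminus> s) / 2\<close>, with multipliers \<open>1 \<plusminus> s\<close>. Hence both multipliers have real part \<open>1\<close> iff \<open>s\<close>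
  is purely imaginary, that is, iff \<open>1 - 4 c\<close> is real and nonpositive.
\<close>

text \<open>By Vieta: the two roots have sum 1 and product \<open>(1 - s\<^sup>2) / 4 = c\<close>.
  Any square root \<open>s\<close> is allowed, including 0, so the double root at
  \<open>c = 1/4\<close> is covered.\<close>

lemma quad_poly_minus_X_factor:
  assumes "s\<^sup>2 = 1 - 4 * c"
  shows "quad_poly c - [:0, 1:] = [:- ((1 + s) / 2), 1:] * [:- ((1 - s) / 2), 1:]"
proof -
  have "(1 + s) / 2 * ((1 - s) / 2) = (1 - s\<^sup>2) / 4"
    by (simp add: field_simps power2_eq_square)
  also have "\<dots> = c"
    using assms by simp
  finally have "c = (1 + s) / 2 * ((1 - s) / 2)" ..
  moreover have "(1 + s) / 2 + (1 - s) / 2 = 1"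
    by (simp add: field_simps)
  ultimately show ?thesis
    by (simp add: quad_poly_def monom_altdef power2_eq_square algebra_simps)
qed

lemma fixed_points_quad_poly:
  assumes "s\<^sup>2 = 1 - 4 * c"
  shows "fixed_points (quad_poly c) = {(1 + s) / 2, (1 - s) / 2}"
proof -
  have "z \<in> fixed_points (quad_poly c) \<longleftrightarrow> z \<in> {(1 + s) / 2, (1 - s) / 2}" for z
  proof -
    have "z \<in> fixed_points (quad_poly c) \<longleftrightarrow> poly (quad_poly c - [:0, 1:]) z = 0"
      by (simp add: fixed_points_def)
    also have "\<dots> \<longleftrightarrow> (z - (1 + s) / 2) * (z - (1 - s) / 2) = 0"
      unfolding quad_poly_minus_X_factor[OF assms] poly_mult by simp
    also have "\<dots> \<longleftrightarrow> z \<in> {(1 + s) / 2, (1 - s) / 2}"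
      by (simp only: mult_eq_0_iff right_minus_eq insert_iff empty_iff simp_thms)
    finally show ?thesis .
  qed
  then show ?thesis
    by blast
qed

lemma multiplier_quad_poly: "multiplier (quad_poly c) z = 2 * z"
  by (simp add: multiplier_def quad_poly_def pderiv_add pderiv_monom poly_monom)

text \<open>Orders add over a nonzero product: the first factor contributes 1, and the second
  contributes 0 because it does not vanish at \<open>a\<close>.\<close>

lemma order_mult_distinct_linear_factors:
  fixes a b :: "'a :: idom"
  assumes "a \<noteq> b"
  shows "order a ([:- a, 1:] * [:- b, 1:]) = 1"
proof -
  have "order a [:- a, 1:] = 1"
    using order_power_n_n[of a 1] by simp
  moreover have "order a [:- b, 1:] = 0"
    using assms by (intro order_0I) auto
  moreover have "[:- a, 1:] * [:- b, 1:] \<noteq> 0"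
    by (metis mult_eq_0_iff pCons_eq_0_iff zero_neq_one)
  ultimately show ?thesis
    by (metis add_0_right order_mult)
qed

lemma simple_fixed_point_quad_poly:
  assumes s: "s\<^sup>2 = 1 - 4 * c" "s \<noteq> 0"
    and z: "z \<in> fixed_points (quad_poly c)"
  shows "simple_fixed_point (quad_poly c) z"
proof -
  let ?a = "(1 + s) / 2" and ?b = "(1 - s) / 2"
  have ne: "?a \<noteq> ?b"
    using \<open>s \<noteq> 0\<close> by (simp add: field_simps add_eq_0_iff2)
  have "z = ?a \<or> z = ?b"
    using z fixed_points_quad_poly[OF s(1)] by blast
  then have "order z (quad_poly c - [:0, 1:]) = 1"
  proof
    assume "z = ?a"
    then show ?thesis
      unfolding quad_poly_minus_X_factor[OF s(1)]
      using order_mult_distinct_linear_factors[OF ne] by blast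
  next
    assume "z = ?b"
    then show ?thesis
      unfolding quad_poly_minus_X_factor[OF s(1)]
      using order_mult_distinct_linear_factors[OF ne[symmetric]]
      by (metis mult.commute)
  qed
  \<comment> \<open>If the difference were zero, so would be the product of two monic linear
    factors, which is impossible in an integral domain.\<close>
  moreover have "quad_poly c \<noteq> [:0, 1:]"
    using quad_poly_minus_X_factor[OF s(1)]
    by (metis diff_self mult_eq_0_iff pCons_eq_0_iff zero_neq_one)
  ultimately show ?thesis
    by (simp add: simple_fixed_point_def)
qed

text \<open>For \<open>s = x + i y\<close>, the square has real part
  \<open>x\<^sup>2 - y\<^sup>2\<close> and imaginary part \<open>2 x y\<close>. If it is real and
  nonpositive, then \<open>x = 0\<close> or \<open>y = 0\<close>, and in the latter case
  \<open>x\<^sup>2 \<le> y\<^sup>2\<close> again forces \<open>x = 0\<close>.\<close>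

lemma Re_eq_0_iff_power2_nonpos_Real:
  fixes s :: complex
  shows "Re s = 0 \<longleftrightarrow> s\<^sup>2 \<in> \<real> \<and> Re (s\<^sup>2) \<le> 0"
proof
  assume "s\<^sup>2 \<in> \<real> \<and> Re (s\<^sup>2) \<le> 0"
  then have "Re s = 0 \<or> Im s = 0" "(Re s)\<^sup>2 \<le> (Im s)\<^sup>2"
    by (auto simp: complex_is_Real_iff power2_eq_square)
  then show "Re s = 0"
    by auto
qed (auto simp: complex_is_Real_iff power2_eq_square)

text \<open>No case split on \<open>c\<close> is needed: for \<open>c = 1/4\<close> the root
  \<open>s\<close> is 0 and both multipliers coincide.\<close>

lemma Re_multipliers_quad_poly_eq_1_iff:
  "(\<forall>z\<in>fixed_points (quad_poly c). Re (multiplier (quad_poly c) z) = 1) \<longleftrightarrow>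
     c \<in> \<real> \<and> Re c \<ge> 1/4"
proof -
  define s where "s = csqrt (1 - 4 * c)"
  have s: "s\<^sup>2 = 1 - 4 * c"
    by (simp add: s_def)
  have "(\<forall>z\<in>fixed_points (quad_poly c). Re (multiplier (quad_poly c) z) = 1) \<longleftrightarrow> Re s = 0"
    unfolding fixed_points_quad_poly[OF s] multiplier_quad_poly by simp
  also have "\<dots> \<longleftrightarrow> c \<in> \<real> \<and> Re c \<ge> 1/4"
    unfolding Re_eq_0_iff_power2_nonpos_Real s by (auto simp: complex_is_Real_iff)
  finally show ?thesis .
qed

theorem theorem3p1:
  fixes c :: complex
  shows
    "(c = 1/4 \<longrightarrow>
        (\<exists>z. fixed_points (quad_poly c) = {z} \<and> multiplier (quad_poly c) z = 1)) \<and>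
     (c \<noteq> 1/4 \<longrightarrow>
        card (fixed_points (quad_poly c)) = 2 \<and>
        (\<forall>z\<in>fixed_points (quad_poly c). simple_fixed_point (quad_poly c) z) \<and>
        ((\<forall>z\<in>fixed_points (quad_poly c). Re (multiplier (quad_poly c) z) = 1) \<longleftrightarrow>
           c \<in> \<real> \<and> Re c > 1/4)) \<and>
     ((\<forall>z\<in>fixed_points (quad_poly c). Re (multiplier (quad_poly c) z) = 1) \<longleftrightarrow>
        c \<in> \<real> \<and> Re c \<ge> 1/4)"
proof (intro conjI impI)
  assume "c = 1/4"
  then have "fixed_points (quad_poly c) = {1/2}"
    \<comment> \<open>The discriminant vanishes, so \<open>s = 0\<close> and both roots collapse to
      \<open>1/2\<close>.\<close>
    using fixed_points_quad_poly[of 0 "1/4"] by (simp only:) simp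
  then show "\<exists>z. fixed_points (quad_poly c) = {z} \<and> multiplier (quad_poly c) z = 1"
    by (intro exI[of _ "1/2"]) (simp add: multiplier_quad_poly)
next
  assume c: "c \<noteq> 1/4"
  define s where "s = csqrt (1 - 4 * c)"
  have s: "s\<^sup>2 = 1 - 4 * c"
    by (simp add: s_def)
  have "s \<noteq> 0"
    using s c by (auto simp: field_simps)
  then have "(1 + s) / 2 \<noteq> (1 - s) / 2"
    by (simp add: field_simps add_eq_0_iff2)
  then show "card (fixed_points (quad_poly c)) = 2"
    unfolding fixed_points_quad_poly[OF s] by simp
  show "\<forall>z\<in>fixed_points (quad_poly c). simple_fixed_point (quad_poly c) z"
    using simple_fixed_point_quad_poly[OF s \<open>s \<noteq> 0\<close>] by blast
  \<comment> \<open>This excludes the boundary value, turning the weak inequality of the general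
    criterion into the strict one.\<close>
  have "c \<in> \<real> \<Longrightarrow> Re c \<noteq> 1/4"
    using c by (auto simp: complex_is_Real_iff complex_eq_iff)
  then show "(\<forall>z\<in>fixed_points (quad_poly c). Re (multiplier (quad_poly c) z) = 1) \<longleftrightarrow>
      c \<in> \<real> \<and> Re c > 1/4"
    unfolding Re_multipliers_quad_poly_eq_1_iff by auto
qed (fact Re_multipliers_quad_poly_eq_1_iff)

end
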